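(* Let $d\ge 2$ and let $\mathcal{H}=(V,H)$ be a paving simplicial complex of dimension $d$. Then the following conditions are equivalent: (i) $\mathcal{H}\in\mathrm{TBPav}(d)$; (ii) $H=\bigcup_{L\in\mathcal{L}} B_d(V,L)$ for some nonempty $\mathcal{L}\subseteq P_{\ge d}(V)\setminus\{V\}$.
   Context: A simplicial complex is a pair $(V,H)$ with $V$ finite nonempty, $H\subseteq 2^V$ containing all singletons and closed under subsets; its dimension is $\max\{|X|:X\in H\}-1$. $P_k(V)$, $P_{\le k}(V)$, $P_{\ge k}(V)$ denote the sets of subsets of $V$ with exactly, at most, at least $k$ elements. A complex of dimension $d$ is paving if $P_{\le d}(V)\subseteq H$. A flat is a set $F\subseteq V$ with $X\cup\{p\}\in H$ for all $X\in H$, $X\subseteq F$, $p\in V\setminus F$. For a chain $F_0\subset\cdots\subset F_k$, a transversal of its successive differences is a set $\{x_1,\dots,x_k\}$ with $x_i\in F_i\setminus F_{i-1}$. A complex is boolean representable (BRSC) if it has a boolean matrix representation; equivalently every face is a transversal of the successive differences of some chain of flats. The $k$-truncation of $(V,H)$ is $(V,H\cap P_{\le k}(V))$; a TBRSC is a complex equal to the $k$-truncation of some BRSC for some $k\ge1$; $\mathrm{TBPav}(d)$ is the class of paving TBRSCs of dimension $d$. For $L\subseteq V$ with $d\le|L|<|V|$, $B_d(V,L)$ is the set of all transversals of successive differences of chains in the Moore family $P_{\le d-1}(V)\cup\{L,V\}$; explicitly $B_d(V,L)=P_{\le d}(V)\cup\{X\in P_{d+1}(V) : |X\cap L|=d\}$.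 *)

theory Defs
  imports Main
begin

definition subsets_eq :: "nat \<Rightarrow> 'a set \<Rightarrow> 'a set set" where
  "subsets_eq k V = {X. X \<subseteq> V \<and> card X = k}"

definition subsets_le :: "nat \<Rightarrow> 'a set \<Rightarrow> 'a set set" where
  "subsets_le k V = {X. X \<subseteq> V \<and> card X \<le> k}"

definition subsets_ge :: "nat \<Rightarrow> 'a set \<Rightarrow> 'a set set" where
  "subsets_ge k V = {X. X \<subseteq> V \<and> k \<le> card X}"

definition simplicial_complex :: "'a set \<Rightarrow> 'a set set \<Rightarrow> bool" where
  "simplicial_complex V H \<longleftrightarrow>
     finite V \<and> V \<noteq> {} \<and> H \<subseteq> Pow V \<and> (\<forall>v\<in>V. {v} \<in> H) \<and>
     (\<forall>X\<in>H. \<forall>Y. Y \<subseteq> X \<longrightarrow> Y \<in> H)"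

text \<open>In a simplicial complex some face is a singleton, so the subtraction does not truncate.\<close>

definition dimension :: "'a set set \<Rightarrow> nat" where
  "dimension H = Max (card ` H) - 1"

definition paving :: "'a set \<Rightarrow> 'a set set \<Rightarrow> bool" where
  "paving V H \<longleftrightarrow> subsets_le (dimension H) V \<subseteq> H"

definition flat :: "'a set \<Rightarrow> 'a set set \<Rightarrow> 'a set \<Rightarrow> bool" where
  "flat V H F \<longleftrightarrow> F \<subseteq> V \<and> (\<forall>X\<in>H. X \<subseteq> F \<longrightarrow> (\<forall>p\<in>V - F. insert p X \<in> H))"

text \<open>The set \<open>X = {x\<^sub>1, \<dots>, x\<^sub>k}\<close> is a transversal of the successive differences of
  \<open>Fs = [F\<^sub>0, \<dots>, F\<^sub>k]\<close>; the lists are indexed from \<open>0\<close>, so \<open>xs ! i\<close> is \<open>x\<^sub>i\<^sub>+\<^sub>1\<close>.\<close>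

definition transversal :: "'a set list \<Rightarrow> 'a set \<Rightarrow> bool" where
  "transversal Fs X \<longleftrightarrow>
     (\<exists>xs. length Fs = Suc (length xs) \<and> set xs = X \<and>
        (\<forall>i<length xs. xs ! i \<in> Fs ! Suc i - Fs ! i))"

definition transversals :: "'a set set \<Rightarrow> 'a set set" where
  "transversals \<F> = {X. \<exists>Fs. set Fs \<subseteq> \<F> \<and> sorted_wrt (\<subset>) Fs \<and> transversal Fs X}"

text \<open>A boolean matrix with row set \<open>{..<m}\<close> and column set \<open>V\<close> is a function
  \<open>M :: nat \<Rightarrow> 'a \<Rightarrow> bool\<close>. A set \<open>X\<close> of columns is independent if there is a set \<open>Y\<close> of rows
  such that the submatrix \<open>M[Y,X]\<close> is, after permuting rows and columns independently, square and
  lower unitriangular (equivalently, nonsingular over the superboolean semiring). The lists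
  \<open>rs\<close> and \<open>xs\<close> enumerate \<open>Y\<close> and \<open>X\<close> in the permuted order.\<close>

definition matrix_independent :: "nat \<Rightarrow> (nat \<Rightarrow> 'a \<Rightarrow> bool) \<Rightarrow> 'a set \<Rightarrow> bool" where
  "matrix_independent m M X \<longleftrightarrow>
     (\<exists>rs xs. distinct rs \<and> set rs \<subseteq> {..<m} \<and> distinct xs \<and> set xs = X \<and>
        length rs = length xs \<and>
        (\<forall>i<length xs. M (rs ! i) (xs ! i)) \<and>
        (\<forall>j<length xs. \<forall>i<j. \<not> M (rs ! i) (xs ! j)))"

definition BRSC :: "'a set \<Rightarrow> 'a set set \<Rightarrow> bool" where
  "BRSC V H \<longleftrightarrow>
     simplicial_complex V H \<and> (\<exists>m M. H = {X. X \<subseteq> V \<and> matrix_independent m M X})"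

definition TBRSC :: "'a set \<Rightarrow> 'a set set \<Rightarrow> bool" where
  "TBRSC V H \<longleftrightarrow>
     simplicial_complex V H \<and> (\<exists>k\<ge>1. \<exists>H'. BRSC V H' \<and> H = H' \<inter> subsets_le k V)"

definition TBPav :: "nat \<Rightarrow> ('a set \<times> 'a set set) set" where
  "TBPav d = {(V, H). TBRSC V H \<and> paving V H \<and> dimension H = d}"

definition B_faces :: "nat \<Rightarrow> 'a set \<Rightarrow> 'a set \<Rightarrow> 'a set set" where
  "B_faces d V L = transversals (subsets_le (d - 1) V \<union> {L, V})"

lemma transversal_distinct:
  assumes "sorted_wrt (\<subset>) Fs" "length Fs = Suc (length xs)"
    and "\<forall>i<length xs. xs ! i \<in> Fs ! Suc i - Fs ! i"
  shows "distinct xs" "\<And>i j. i < j \<Longrightarrow> j \<le> length xs \<Longrightarrow> xs ! i \<in> Fs ! j"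
proof -
  show *: "xs ! i \<in> Fs ! j" if "i < j" "j \<le> length xs" for i j
  proof (cases "Suc i = j")
    case False
    then have "Fs ! Suc i \<subset> Fs ! j"
      using that assms by (intro sorted_wrt_nth_less[OF assms(1)]) auto
    moreover have "xs ! i \<in> Fs ! Suc i" using that assms(3) by auto
    ultimately show ?thesis by blast
  qed (use that assms in auto)
  have "xs ! i \<noteq> xs ! j" if "i < j" "j < length xs" for i j
    using *[of i j] that assms(3) by auto
  then show "distinct xs" unfolding distinct_conv_nth by (metis linorder_neqE_nat)
qed

lemma transversalsI:
  assumes "set Fs \<subseteq> \<F>" "length Fs = Suc (length xs)" "set xs = X"
    and inc: "\<And>i. i < length xs \<Longrightarrow> Fs ! i \<subseteq> Fs ! Suc i"
    and tr: "\<And>i. i < length xs \<Longrightarrow> xs ! i \<in> Fs ! Suc i - Fs ! i"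
  shows "X \<in> transversals \<F>"
proof -
  have "sorted_wrt (\<subset>) Fs"
    unfolding sorted_wrt_iff_nth_Suc_transp[OF transp_on_less]
    using inc tr assms(2) by (metis Diff_iff Suc_less_eq psubsetI)
  then show ?thesis using assms unfolding transversals_def transversal_def by blast
qed

lemma B_faces_explicit:
  assumes fin: "finite V" and d: "d \<ge> 1" and L: "L \<subseteq> V" "d \<le> card L" "card L < card V"
  shows "B_faces d V L = subsets_le d V \<union> {X \<in> subsets_eq (d + 1) V. card (X \<inter> L) = d}"
proof (intro equalityI subsetI)
  fix X assume "X \<in> B_faces d V L"
  then obtain Fs xs where Fs: "set Fs \<subseteq> subsets_le (d - 1) V \<union> {L, V}" "sorted_wrt (\<subset>) Fs"
    and len: "length Fs = Suc (length xs)" and X: "set xs = X"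
    and tr: "\<forall>i<length xs. xs ! i \<in> Fs ! Suc i - Fs ! i"
    unfolding B_faces_def transversals_def transversal_def by auto
  note dist = transversal_distinct[OF Fs(2) len tr]
  have mem: "Fs ! i \<in> subsets_le (d - 1) V \<union> {L, V}" if "i \<le> length xs" for i
    using Fs(1) len that by (metis le_imp_less_Suc nth_mem subset_iff)
  have sub: "Fs ! i \<subseteq> V" if "i \<le> length xs" for i
    using mem[OF that] L by (auto simp: subsets_le_def)
  have XV: "X \<subseteq> V"
    using X dist(2)[of _ "length xs"] sub[of "length xs"] by (metis in_set_conv_nth order_refl subset_iff)
  have ge: "i \<le> card (Fs ! i)" if "i \<le> length xs" for i
  proof -
    have "set (take i xs) \<subseteq> Fs ! i" using dist(2) that by (auto simp: in_set_conv_nth)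
    then have "card (set (take i xs)) \<le> card (Fs ! i)"
      by (rule card_mono[rotated]) (use sub[OF that] fin finite_subset in auto)
    then show ?thesis using dist(1) that by (simp add: distinct_card)
  qed
  have top: "Fs ! i = L \<or> Fs ! i = V" if "i \<le> length xs" "d \<le> i" for i
    using mem[OF that(1)] ge[OF that(1)] that d by (auto simp: subsets_le_def)
  have lt: "Fs ! i \<subset> Fs ! j" if "i < j" "j \<le> length xs" for i j
    using that len by (intro sorted_wrt_nth_less[OF Fs(2)]) auto
  have cX: "card X = length xs" using X dist(1) by (auto simp: distinct_card)
  have le: "length xs \<le> d + 1"
  proof (rule ccontr)
    assume "\<not> ?thesis"
    then show False
      using top[of d] top[of "d+1"] top[of "d+2"] lt[of d "d+1"] lt[of "d+1" "d+2"] lt[of d "d+2"] L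
      by auto
  qed
  show "X \<in> subsets_le d V \<union> {X \<in> subsets_eq (d + 1) V. card (X \<inter> L) = d}"
  proof (cases "length xs = d + 1")
    case True
    have "Fs ! d = L" using top[of d] top[of "d+1"] lt[of d "d+1"] L True by auto
    then have in_L: "xs ! i \<in> L \<longleftrightarrow> i < d" if "i < length xs" for i
      using tr dist(2)[of i d] that True by (cases "i = d") auto
    have "X \<inter> L = set (take d xs)"
    proof (intro equalityI subsetI)
      fix x assume "x \<in> X \<inter> L"
      then obtain i where "i < length xs" "x = xs ! i" "i < d" using X in_L by (auto simp: in_set_conv_nth)
      then show "x \<in> set (take d xs)" by (auto simp: in_set_conv_nth)
    next
      fix x assume "x \<in> set (take d xs)"
      then obtain i where "i < length xs" "x = xs ! i" "i < d" by (auto simp: in_set_conv_nth)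
      then show "x \<in> X \<inter> L" using in_L X by auto
    qed
    then have "card (X \<inter> L) = d" using dist(1) True by (simp add: distinct_card)
    then show ?thesis using XV cX True by (auto simp: subsets_eq_def)
  qed (use le XV cX in \<open>auto simp: subsets_le_def\<close>)
next
  fix X assume X: "X \<in> subsets_le d V \<union> {X \<in> subsets_eq (d + 1) V. card (X \<inter> L) = d}"
  then have XV: "X \<subseteq> V" by (auto simp: subsets_le_def subsets_eq_def)
  then have finX: "finite X" using fin finite_subset by blast
  show "X \<in> B_faces d V L"
  proof (cases "card X \<le> d")
    case True
    obtain xs where xs: "set xs = X" "distinct xs" using finX finite_distinct_list by blast
    then have len: "length xs \<le> d" using True by (simp add: distinct_card flip: xs(1))
    show ?thesis
    proof (cases "xs = []")
      case True
      then show ?thesis unfolding B_faces_def using xs(1)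
        by (intro transversalsI[where Fs="[{}]" and xs=xs]) (auto simp: subsets_le_def)
    next
      case False
      let ?Fs = "map (\<lambda>i. set (take i xs)) [0..<length xs] @ [V]"
      have "set (take i xs) \<in> subsets_le (d - 1) V" if "i < length xs" for i
        using that len xs XV d set_take_subset[of i xs]
        by (auto simp: subsets_le_def distinct_card)
      moreover have "xs ! i \<notin> set (take i xs)" if "i < length xs" for i
        using xs(2) that by (auto simp: in_set_conv_nth nth_eq_iff_index_eq)
      ultimately show ?thesis unfolding B_faces_def using xs(1) XV
        by (intro transversalsI[where Fs="?Fs" and xs=xs])
          (auto simp: nth_append take_Suc_conv_app_nth less_Suc_eq dest: in_set_takeD)
    qed
  next
    case False
    then have c: "card X = d + 1" "card (X \<inter> L) = d"
      using X by (auto simp: subsets_le_def subsets_eq_def)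
    obtain ys where ys: "set ys = X \<inter> L" "distinct ys" using finX finite_distinct_list by blast
    have len: "length ys = d" using ys c by (metis distinct_card)
    have "card (X - L) = 1" using card_Diff_subset_Int[of X L] c finX by simp
    then obtain p where p: "X - L = {p}" by (auto simp: card_1_singleton_iff)
    let ?Fs = "map (\<lambda>i. set (take i ys)) [0..<d] @ [L, V]"
    have "set (take i ys) \<in> subsets_le (d - 1) V" if "i < d" for i
      using that len ys XV d set_take_subset[of i ys] by (auto simp: subsets_le_def distinct_card)
    moreover have "ys ! i \<notin> set (take i ys)" if "i < d" for i
      using ys(2) that len by (auto simp: in_set_conv_nth nth_eq_iff_index_eq)
    moreover have "ys ! i \<in> L" if "i < d" for i using ys(1) len that nth_mem[of i ys] by auto
    moreover have "set (ys @ [p]) = X" using ys p by auto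
    ultimately show ?thesis unfolding B_faces_def using XV L ys(1) len p
      by (intro transversalsI[where Fs="?Fs" and xs="ys @ [p]"])
        (auto simp: nth_append take_Suc_conv_app_nth less_Suc_eq dest: in_set_takeD)
  qed
qed

lemma BRSC_iff_transversals_flats:
  "BRSC V H \<longleftrightarrow> simplicial_complex V H \<and> H \<subseteq> transversals {F. flat V H F}"
proof (intro iffI conjI)
  assume "BRSC V H"
  then show sc: "simplicial_complex V H" by (simp add: BRSC_def)
  obtain m M where H: "H = {X. X \<subseteq> V \<and> matrix_independent m M X}"
    using \<open>BRSC V H\<close> by (auto simp: BRSC_def)
  have Z: "flat V H {v \<in> V. \<not> M r v}" if r: "r < m" for r
    unfolding flat_def
  proof (intro conjI ballI impI)
    fix X p assume X: "X \<in> H" "X \<subseteq> {v \<in> V. \<not> M r v}" and p: "p \<in> V - {v \<in> V. \<not> M r v}"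
    obtain rs xs where *: "distinct rs" "set rs \<subseteq> {..<m}" "distinct xs" "set xs = X"
      "length rs = length xs" "\<forall>i<length xs. M (rs ! i) (xs ! i)"
      "\<forall>j<length xs. \<forall>i<j. \<not> M (rs ! i) (xs ! j)"
      using X(1) H by (auto simp: matrix_independent_def)
    have "r \<notin> set rs"
    proof
      assume "r \<in> set rs"
      then obtain i where "i < length rs" "rs ! i = r" by (auto simp: in_set_conv_nth)
      then show False using * X(2) nth_mem[of i xs] by auto
    qed
    then have "matrix_independent m M (insert p X)"
      unfolding matrix_independent_def using * X(2) p r
      by (intro exI[of _ "r # rs"] exI[of _ "p # xs"])
        (auto simp: nth_Cons less_Suc_eq_0_disj split: nat.splits)
    then show "insert p X \<in> H" using H X p by auto
  qed auto
  have Int: "flat V H (V \<inter> (\<Inter>i\<in>I. F i))" if "\<And>i. i \<in> I \<Longrightarrow> flat V H (F i)" for I and F :: "nat \<Rightarrow> _"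
    using that unfolding flat_def by blast
  show "H \<subseteq> transversals {F. flat V H F}"
  proof
    fix X assume X: "X \<in> H"
    then obtain rs xs where *: "distinct rs" "set rs \<subseteq> {..<m}" "distinct xs" "set xs = X"
      "length rs = length xs" "\<forall>i<length xs. M (rs ! i) (xs ! i)"
      "\<forall>j<length xs. \<forall>i<j. \<not> M (rs ! i) (xs ! j)"
      using H by (auto simp: matrix_independent_def)
    define F where "F = (\<lambda>j. V \<inter> (\<Inter>i\<in>{..<length xs - j}. {v \<in> V. \<not> M (rs ! i) v}))"
    have XV: "xs ! i \<in> V" if "i < length xs" for i using X H * that nth_mem[of i xs] by auto
    have fl: "flat V H (F j)" for j
      unfolding F_def
    proof (intro Int Z)
      fix i assume "i \<in> {..<length xs - j}"
      then have "i < length rs" using * by auto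
      then show "rs ! i < m" using *(2) by (metis lessThan_iff nth_mem subsetD)
    qed
    show "X \<in> transversals {F. flat V H F}"
    proof (rule transversalsI[where Fs="map F [0..<Suc (length xs)]" and xs="rev xs"])
      fix i assume i: "i < length (rev xs)"
      show "map F [0..<Suc (length xs)] ! i \<subseteq> map F [0..<Suc (length xs)] ! Suc i"
        using i by (auto simp: F_def nth_append)
      have "xs ! (length xs - Suc i) \<in> F (Suc i) - F i"
        using i * XV unfolding F_def
        by (auto intro!: bexI[of _ "length xs - Suc i"])
      then show "rev xs ! i \<in> map F [0..<Suc (length xs)] ! Suc i - map F [0..<Suc (length xs)] ! i"
        using i by (simp add: rev_nth del: upt_Suc)
    qed (use * fl in auto)
  qed
next
  assume asm: "simplicial_complex V H \<and> H \<subseteq> transversals {F. flat V H F}"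
  then have sc: "simplicial_complex V H" by simp
  have "finite {F. flat V H F}"
    by (rule finite_subset[of _ "Pow V"]) (use sc in \<open>auto simp: flat_def simplicial_complex_def\<close>)
  then obtain m :: nat and f :: "nat \<Rightarrow> 'a set" where f: "{F. flat V H F} = f ` {i. i < m}"
    using finite_imp_nat_seg_image_inj_on by metis
  define M where "M = (\<lambda>r v. v \<notin> f r)"
  have "X \<in> H" if XV: "X \<subseteq> V" and X: "matrix_independent m M X" for X
  proof -
    obtain rs xs where *: "set rs \<subseteq> {..<m}" "set xs = X"
      "length rs = length xs" "\<forall>i<length xs. M (rs ! i) (xs ! i)"
      "\<forall>j<length xs. \<forall>i<j. \<not> M (rs ! i) (xs ! j)"
      using X by (auto simp: matrix_independent_def)
    have "set (drop (length xs - n) xs) \<in> H" for n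
    proof (induction n)
      case 0
      obtain v where "v \<in> V" using sc by (auto simp: simplicial_complex_def)
      then have "{v} \<in> H" using sc by (auto simp: simplicial_complex_def)
      then have "{} \<in> H" using sc unfolding simplicial_complex_def by blast
      then show ?case by simp
    next
      case (Suc n)
      show ?case
      proof (cases "n < length xs")
        case True
        let ?i = "length xs - Suc n"
        have i: "?i < length xs" "Suc ?i = length xs - n" using True by auto
        have "rs ! ?i < m" using *(1,3) i(1) by (metis lessThan_iff nth_mem subsetD)
        then have fl: "flat V H (f (rs ! ?i))" using f by blast
        have "set (drop (Suc ?i) xs) \<subseteq> f (rs ! ?i)"
          using *(5) by (auto simp: in_set_conv_nth M_def)
        moreover have "xs ! ?i \<in> V - f (rs ! ?i)" using *(2,4) i XV nth_mem[of ?i xs] by (auto simp: M_def)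
        ultimately have "insert (xs ! ?i) (set (drop (Suc ?i) xs)) \<in> H"
          using fl Suc i(2) unfolding flat_def by metis
        then show ?thesis using Cons_nth_drop_Suc[OF i(1), symmetric] by simp
      qed (use Suc in simp)
    qed
    from this[of "length xs"] show ?thesis using * by simp
  qed
  moreover have "X \<subseteq> V \<and> matrix_independent m M X" if X: "X \<in> H" for X
  proof
    show "X \<subseteq> V" using sc X by (auto simp: simplicial_complex_def)
    obtain Fs xs where Fs: "set Fs \<subseteq> {F. flat V H F}" "sorted_wrt (\<subset>) Fs"
      and len: "length Fs = Suc (length xs)" and xs: "set xs = X"
      and tr: "\<forall>i<length xs. xs ! i \<in> Fs ! Suc i - Fs ! i"
      using asm X unfolding transversals_def transversal_def by blast
    note dist = transversal_distinct[OF Fs(2) len tr]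
    define g where "g = inv_into {i. i < m} f"
    have g: "g F < m" "f (g F) = F" if "F \<in> set Fs" for F
    proof -
      have "F \<in> f ` {i. i < m}" using that Fs(1) f by blast
      then show "g F < m" "f (g F) = F"
        unfolding g_def using inv_into_into[of F f "{i. i < m}"] by (auto simp: f_inv_into_f)
    qed
    let ?rs = "map g (rev (butlast Fs))"
    have nth: "?rs ! i = g (Fs ! (length xs - Suc i))" if "i < length xs" for i
      using that len by (simp add: rev_nth nth_butlast)
    have ff: "f (?rs ! i) = Fs ! (length xs - Suc i)" if "i < length xs" for i
      using nth[OF that] g(2) len that by simp
    have "distinct Fs"
      unfolding distinct_conv_nth
      using sorted_wrt_nth_less[OF Fs(2)] by (metis linorder_neqE_nat psubset_eq)
    moreover have "inj_on g (set Fs)" by (rule inj_on_inverseI[where g=f]) (rule g(2))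
    ultimately have "distinct ?rs"
      by (auto simp: distinct_map distinct_butlast intro: inj_on_subset dest: in_set_butlastD)
    moreover have "set ?rs \<subseteq> {..<m}" using g(1) by (auto dest: in_set_butlastD)
    moreover have "M (?rs ! i) (rev xs ! i)" if "i < length xs" for i
      using ff[OF that] tr that unfolding M_def by (simp add: rev_nth)
    moreover have "\<not> M (?rs ! i) (rev xs ! j)" if "j < length xs" "i < j" for i j
      using ff[of i] dist(2)[of "length xs - Suc j" "length xs - Suc i"] that unfolding M_def
      by (simp add: rev_nth)
    ultimately show "matrix_independent m M X"
      unfolding matrix_independent_def using dist(1) xs len
      by (intro exI[of _ ?rs] exI[of _ "rev xs"]) auto
  qed
  ultimately show "BRSC V H" using sc unfolding BRSC_def by blast
qed

end

theory Submission
  imports Defs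
begin

text \<open>A set of columns of a boolean matrix is independent iff each of its nonempty subsets \<open>Y\<close> is
  separated by some row, i.e. \<open>Y\<close> meets the complement of the zero set \<open>F\<close> of that row in exactly
  one point. Hence a BRSC is given by the finite family of zero sets of its rows. If \<open>H\<close> is the
  truncation of such a complex, the zero sets with at least \<open>d\<close> elements that separate the facets
  of size \<open>d + 1\<close> serve as \<open>\<L>\<close>. Conversely, \<open>\<L>\<close> together with all sets of at most \<open>d - 1\<close>
  elements is the family of zero sets of a matrix whose complex truncates to \<open>H\<close>: only members
  of \<open>\<L>\<close> are large enough to separate a set of \<open>d + 1\<close> points.\<close>

section \<open>Separated sets and boolean matrices\<close>

definition separated :: "'a set set \<Rightarrow> 'a set \<Rightarrow> bool" where
  "separated \<F> X \<longleftrightarrow> (\<forall>Y. Y \<subseteq> X \<longrightarrow> Y \<noteq> {} \<longrightarrow> (\<exists>F\<in>\<F>. \<exists>y. Y - F = {y}))"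

lemma separated_subset: "separated \<F> X \<Longrightarrow> Y \<subseteq> X \<Longrightarrow> separated \<F> Y"
  unfolding separated_def by (meson subset_trans)

text \<open>A nonempty subset of \<open>X\<close> containing \<open>p\<close> is separated by
  \<open>F\<close> itself; one avoiding \<open>p\<close> lies in \<open>X \<inter> F\<close>. This
  mirrors the defining property of a flat: a point outside \<open>F\<close> may be added to an
  independent subset of \<open>F\<close>.\<close>

lemma separated_extend:
  assumes "separated \<F> (X \<inter> F)" "F \<in> \<F>" "X - F = {p}"
  shows "separated \<F> X"
  unfolding separated_def
proof (intro allI impI)
  fix Y assume Y: "Y \<subseteq> X" "Y \<noteq> {}"
  show "\<exists>F\<in>\<F>. \<exists>y. Y - F = {y}"
  proof (cases "p \<in> Y")
    case True
    then have "Y - F = {p}" using Y assms(3) by blast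
    then show ?thesis using assms(2) by blast
  next
    case False
    then have "Y \<subseteq> X \<inter> F" using Y(1) assms(3) by (auto simp: set_eq_iff)
    then show ?thesis using assms(1) Y unfolding separated_def by blast
  qed
qed

text \<open>In a unitriangular arrangement the row paired with the first column of \<open>Y\<close>
  has a one there and zeros at all later columns, so its zero set misses exactly one point of
  \<open>Y\<close>.\<close>

lemma matrix_independent_imp_separated:
  assumes "matrix_independent m M X"
  shows "separated ((\<lambda>r. {v. \<not> M r v}) ` {..<m}) X"
  unfolding separated_def
proof (intro allI impI)
  obtain rs xs where *: "set rs \<subseteq> {..<m}" "set xs = X" "length rs = length xs"
    "\<forall>i<length xs. M (rs ! i) (xs ! i)" "\<forall>j<length xs. \<forall>i<j. \<not> M (rs ! i) (xs ! j)"
    using assms by (auto simp: matrix_independent_def)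
  fix Y assume Y: "Y \<subseteq> X" "Y \<noteq> {}"
  define P where "P = (\<lambda>i. i < length xs \<and> xs ! i \<in> Y)"
  have ex: "\<exists>i. P i" using Y *(2) unfolding P_def by (metis all_not_in_conv in_set_conv_nth subsetD)
  define i where "i = (LEAST i. P i)"
  have i: "i < length xs" "xs ! i \<in> Y" using LeastI_ex[OF ex] unfolding i_def P_def by auto
  have "\<not> M (rs ! i) y" if y: "y \<in> Y" "y \<noteq> xs ! i" for y
  proof -
    obtain j where j: "j < length xs" "xs ! j = y"
      using y(1) Y(1) *(2) by (metis in_set_conv_nth subsetD)
    then have "i \<le> j" using y(1) unfolding i_def by (intro Least_le) (simp add: P_def)
    then have "i < j" using j y(2) by (cases "i = j") auto
    then show ?thesis using *(5) j by blast
  qed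
  then have "Y - {v. \<not> M (rs ! i) v} = {xs ! i}" using i *(4) by auto
  moreover have "rs ! i < m" using *(1,3) i(1) by (metis lessThan_iff nth_mem subsetD)
  ultimately show "\<exists>F\<in>(\<lambda>r. {v. \<not> M r v}) ` {..<m}. \<exists>y. Y - F = {y}" by blast
qed

text \<open>A row that separates \<open>X\<close> itself has exactly one 1 on \<open>X\<close>, at
  some \<open>y\<close>. Put this row and \<open>y\<close> first and arrange \<open>X - {y}\<close>
  by induction; the zeros of the row on \<open>X - {y}\<close> are those required by
  unitriangularity.\<close>

lemma separated_imp_matrix_independent:
  assumes "finite X" "separated ((\<lambda>r. {v. \<not> M r v}) ` {..<m}) X"
  shows "matrix_independent m M X"
  using assms
proof (induction X rule: finite_psubset_induct)
  case (psubset X)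
  show ?case
  proof (cases "X = {}")
    case True
    then show ?thesis by (simp add: matrix_independent_def)
  next
    case False
    then obtain r y where r: "r < m" and y: "X - {v. \<not> M r v} = {y}"
      using psubset.prems unfolding separated_def by blast
    have "X - {y} \<subset> X" using y by blast
    moreover have "separated ((\<lambda>r. {v. \<not> M r v}) ` {..<m}) (X - {y})"
      using psubset.prems by (rule separated_subset) blast
    ultimately have "matrix_independent m M (X - {y})" by (rule psubset.IH)
    then obtain rs xs where *: "distinct rs" "set rs \<subseteq> {..<m}" "distinct xs" "set xs = X - {y}"
      "length rs = length xs" "\<forall>i<length xs. M (rs ! i) (xs ! i)"
      "\<forall>j<length xs. \<forall>i<j. \<not> M (rs ! i) (xs ! j)"
      by (auto simp: matrix_independent_def)
    have zero: "\<not> M r (xs ! i)" if "i < length xs" for i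
      using nth_mem[OF that] *(4) y by auto
    \<comment> \<open>Row \<open>r\<close> vanishes on \<open>X - {y}\<close>, whereas each row in
      \<open>rs\<close> has its diagonal 1 there.\<close>
    have "r \<notin> set rs" using zero *(5,6) by (metis in_set_conv_nth)
    moreover have "set (y # xs) = X" using *(4) y by auto
    moreover have "M r y" using y by blast
    ultimately show ?thesis
      unfolding matrix_independent_def using * r zero
      by (intro exI[of _ "r # rs"] exI[of _ "y # xs"])
        (auto simp: nth_Cons less_Suc_eq_0_disj split: nat.splits)
  qed
qed

lemma BRSC_iff_separated:
  "BRSC V H \<longleftrightarrow>
    simplicial_complex V H \<and> (\<exists>\<F>. finite \<F> \<and> H = {X. X \<subseteq> V \<and> separated \<F> X})"
proof (cases "finite V")
  case True
  have eq: "{X. X \<subseteq> V \<and> matrix_independent m M X} =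
      {X. X \<subseteq> V \<and> separated ((\<lambda>r. {v. \<not> M r v}) ` {..<m}) X}" for m and M :: "nat \<Rightarrow> 'a \<Rightarrow> bool"
    by (rule Collect_cong, rule conj_cong[OF refl], rule iffI,
        erule matrix_independent_imp_separated,
        rule separated_imp_matrix_independent[OF finite_subset[OF _ True]])
  show ?thesis
    unfolding BRSC_def eq
  proof (intro conj_cong refl iffI; elim exE conjE)
    fix m and M :: "nat \<Rightarrow> 'a \<Rightarrow> bool"
    assume "H = {X. X \<subseteq> V \<and> separated ((\<lambda>r. {v. \<not> M r v}) ` {..<m}) X}"
    then show "\<exists>\<F>. finite \<F> \<and> H = {X. X \<subseteq> V \<and> separated \<F> X}"
      by (intro exI[of _ "(\<lambda>r. {v. \<not> M r v}) ` {..<m}"]) simp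
  next
    fix \<F> assume fin: "finite \<F>" and H: "H = {X. X \<subseteq> V \<and> separated \<F> X}"
    obtain m :: nat and f where "\<F> = f ` {i. i < m}"
      using finite_imp_nat_seg_image_inj_on[OF fin] by metis
    then have "\<F> = (\<lambda>r. {v. \<not> (v \<notin> f r)}) ` {..<m}" by (simp add: lessThan_def)
    then show "\<exists>m M. H = {X. X \<subseteq> V \<and> separated ((\<lambda>r. {v. \<not> M r v}) ` {..<m :: nat}) X}"
      using H by (intro exI[of _ m] exI[of _ "\<lambda>r v. v \<notin> f r"]) simp
  qed
\<comment> \<open>For infinite \<open>V\<close> both sides fail, since a simplicial complex has
  finite vertex set.\<close>
qed (simp add: BRSC_def simplicial_complex_def)

section \<open>Cardinalities, \<open>B_faces\<close> and facets\<close>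

lemma card_Int_if_Diff_singleton:
  assumes "finite X" "X - F = {p}"
  shows "card X = Suc (card (X \<inter> F))"
proof -
  have "X = insert p (X \<inter> F)" "p \<notin> X \<inter> F" using assms(2) by blast+
  then show ?thesis using assms(1) card_insert_disjoint[of "X \<inter> F" p] by simp
qed

text \<open>A set of size \<open>d + 1\<close> meets \<open>L\<close> in \<open>d\<close> points iff
  it has one point outside \<open>L\<close>. The latter form is the one in which
  \<open>separated\<close> speaks of \<open>L\<close>.\<close>

lemma B_faces_eq:
  assumes fin: "finite V" and "d \<ge> 1" and L: "L \<in> subsets_ge d V - {V}"
  shows "B_faces d V L = subsets_le d V \<union> {X \<in> subsets_eq (d + 1) V. \<exists>p. X - L = {p}}"
proof -
  have "card L < card V" using L fin by (auto simp: subsets_ge_def intro: psubset_card_mono)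
  then have B: "B_faces d V L = subsets_le d V \<union> {X \<in> subsets_eq (d + 1) V. card (X \<inter> L) = d}"
    using assms by (intro B_faces_explicit) (auto simp: subsets_ge_def)
  have "card (X \<inter> L) = d \<longleftrightarrow> (\<exists>p. X - L = {p})" if X: "X \<subseteq> V" "card X = d + 1" for X
  proof -
    have "finite X" using X fin finite_subset by blast
    then have "card (X - L) = d + 1 - card (X \<inter> L)" "card (X \<inter> L) \<le> d + 1"
      using X card_Diff_subset_Int[of X L] card_mono[of X "X \<inter> L"] by auto
    then have "card (X \<inter> L) = d \<longleftrightarrow> card (X - L) = 1" using X by auto
    then show ?thesis by (simp add: card_1_singleton_iff)
  qed
  then show ?thesis unfolding B by (auto simp: subsets_eq_def)
qed

lemma simplicial_complex_card_le:
  assumes "simplicial_complex V H" "X \<in> H"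
  shows "card X \<le> dimension H + 1"
proof -
  have "finite H" using assms(1) unfolding simplicial_complex_def
    by (metis finite_Pow_iff finite_subset)
  then have "card X \<le> Max (card ` H)" using assms(2) by simp
  then show ?thesis by (simp add: dimension_def)
qed

text \<open>A singleton face makes the maximal face size at least 1, so the subtraction in
  \<open>dimension\<close> does not truncate.\<close>

lemma simplicial_complex_ex_facet:
  assumes "simplicial_complex V H"
  shows "\<exists>X\<in>H. card X = dimension H + 1"
proof -
  have fin: "finite H" using assms unfolding simplicial_complex_def
    by (metis finite_Pow_iff finite_subset)
  obtain v where v: "{v} \<in> H" using assms by (auto simp: simplicial_complex_def)
  then have "card {v} \<le> Max (card ` H)" using fin by (intro Max_ge) (auto intro: rev_image_eqI)
  moreover have "Max (card ` H) \<in> card ` H" using fin v by (intro Max_in) auto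
  ultimately show ?thesis unfolding dimension_def by force
qed

section \<open>From a truncated representation to a union\<close>

lemma TBRSC_imp_Union_B_faces:
  assumes "d \<ge> 1" and sc: "simplicial_complex V H" and pav: "paving V H"
    and dim: "dimension H = d" and "TBRSC V H"
  shows "\<exists>\<L>. \<L> \<noteq> {} \<and> \<L> \<subseteq> subsets_ge d V - {V} \<and> H = (\<Union>L\<in>\<L>. B_faces d V L)"
proof -
  have finV: "finite V" and HV: "H \<subseteq> Pow V" using sc by (auto simp: simplicial_complex_def)
  obtain k \<F> where H: "H = {X. X \<subseteq> V \<and> separated \<F> X} \<inter> subsets_le k V"
    using \<open>TBRSC V H\<close> unfolding TBRSC_def BRSC_iff_separated by blast
  obtain X0 where X0: "X0 \<in> H" "card X0 = d + 1"
    using simplicial_complex_ex_facet[OF sc] dim by auto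
  \<comment> \<open>A facet of size \<open>d + 1\<close> survives the truncation, so the bound
    \<open>k\<close> excludes no set of that size.\<close>
  then have k: "d + 1 \<le> k" using H by (auto simp: subsets_le_def)
  have low: "subsets_le d V \<subseteq> H" using pav dim by (simp add: paving_def)
  \<comment> \<open>Members of \<open>\<F>\<close> may contain points outside \<open>V\<close>,
    hence the traces on \<open>V\<close>. All large proper traces are taken, whether or not they
    separate a facet.\<close>
  define \<L> where "\<L> = {F \<inter> V |F. F \<in> \<F> \<and> d \<le> card (F \<inter> V) \<and> \<not> V \<subseteq> F}"
  have \<L>: "\<L> \<subseteq> subsets_ge d V - {V}" unfolding \<L>_def subsets_ge_def by auto
  note B = B_faces_eq[OF finV \<open>d \<ge> 1\<close> subsetD[OF \<L>]]
  \<comment> \<open>Separation is applied to \<open>X\<close> as a whole: \<open>F\<close> contains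
    all but one of its \<open>d + 1\<close> points, so its trace has at least \<open>d\<close>
    elements, and \<open>p\<close> shows that it is proper.\<close>
  have top: "\<exists>L\<in>\<L>. X \<in> B_faces d V L" if X: "X \<in> H" "card X = d + 1" for X
  proof -
    have XV: "X \<subseteq> V" and fin: "finite X" using X HV finV finite_subset by blast+
    have "X \<noteq> {}" "separated \<F> X" using X H by auto
    then obtain F p where F: "F \<in> \<F>" "X - F = {p}" unfolding separated_def by blast
    have "card (X \<inter> F) = d" using card_Int_if_Diff_singleton[OF fin F(2)] X by simp
    moreover have "card (X \<inter> F) \<le> card (F \<inter> V)" using XV finV by (intro card_mono) auto
    ultimately have L: "F \<inter> V \<in> \<L>" using F XV unfolding \<L>_def by blast
    have "X - F \<inter> V = {p}" using F XV by blast
    then have "X \<in> B_faces d V (F \<inter> V)" using B[OF L] X XV by (auto simp: subsets_eq_def)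
    then show ?thesis using L by blast
  qed
  have "B_faces d V L \<subseteq> H" if L: "L \<in> \<L>" for L
  proof
    fix X assume "X \<in> B_faces d V L"
    then consider "X \<in> subsets_le d V" | p where "X \<subseteq> V" "card X = d + 1" "X - L = {p}"
      unfolding B[OF L] by (auto simp: subsets_eq_def)
    then show "X \<in> H"
    proof cases
      case 1
      then show ?thesis using low by blast
    next
      case 2
      obtain F where F: "F \<in> \<F>" "L = F \<inter> V" using L unfolding \<L>_def by blast
      have fin: "finite X" using 2 finV finite_subset by blast
      have XF: "X - F = {p}" using 2 F by blast
      have "card (X \<inter> F) = d" using card_Int_if_Diff_singleton[OF fin XF] 2 by simp
      \<comment> \<open>Paving makes this \<open>d\<close>-element set a face, hence separated;
        \<open>F\<close> then allows \<open>p\<close> to be added.\<close>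
      then have "X \<inter> F \<in> H" using low 2 by (auto simp: subsets_le_def)
      then have "separated \<F> X" using H F XF by (intro separated_extend[of \<F> X F p]) auto
      then show ?thesis using H 2 k by (auto simp: subsets_le_def)
    qed
  qed
  \<comment> \<open>Besides showing \<open>\<L>\<close> nonempty, any such \<open>L0\<close> covers
    all faces of size at most \<open>d\<close>.\<close>
  moreover obtain L0 where "L0 \<in> \<L>" using top[OF X0] by blast
  moreover have "X \<in> (\<Union>L\<in>\<L>. B_faces d V L)" if X: "X \<in> H" for X
  proof (cases "card X = d + 1")
    case True
    then show ?thesis using top[OF X] by blast
  next
    case False
    then have "X \<in> subsets_le d V"
      using simplicial_complex_card_le[OF sc X] dim X HV by (auto simp: subsets_le_def)
    then show ?thesis using B[OF \<open>L0 \<in> \<L>\<close>] \<open>L0 \<in> \<L>\<close> by blast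
  qed
  ultimately show ?thesis using \<L> by (intro exI[of _ \<L>]) blast
qed

section \<open>From a union to a truncated representation\<close>

lemma Union_B_faces_imp_TBRSC:
  assumes "d \<ge> 1" and sc: "simplicial_complex V H" and "\<L> \<noteq> {}"
    and \<L>: "\<L> \<subseteq> subsets_ge d V - {V}" and H: "H = (\<Union>L\<in>\<L>. B_faces d V L)"
  shows "TBRSC V H"
proof -
  have finV: "finite V" and neV: "V \<noteq> {}" using sc by (auto simp: simplicial_complex_def)
  note B = B_faces_eq[OF finV \<open>d \<ge> 1\<close> subsetD[OF \<L>]]
  have mem: "X \<in> H \<longleftrightarrow> X \<subseteq> V \<and> (card X \<le> d \<or> card X = d + 1 \<and> (\<exists>L\<in>\<L>. \<exists>p. X - L = {p}))"
    for X using H B \<open>\<L> \<noteq> {}\<close> by (auto simp: subsets_le_def subsets_eq_def)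
  define \<F> where "\<F> = subsets_le (d - 1) V \<union> \<L>"
  define H' where "H' = {X. X \<subseteq> V \<and> separated \<F> X}"
  have "\<F> \<subseteq> Pow V" using \<L> by (auto simp: \<F>_def subsets_le_def subsets_ge_def)
  then have fin: "finite \<F>" using finV by (metis finite_Pow_iff finite_subset)
  have HH': "H \<subseteq> H'"
  proof
    fix X assume X: "X \<in> H"
    \<comment> \<open>Every \<open>Y\<close> is again a face. If it has at most \<open>d\<close>
      points, removing one leaves a separating set of size at most \<open>d - 1\<close>; otherwise
      it has \<open>d + 1\<close> points and a member of \<open>\<L>\<close> separates it.\<close>
    have "\<exists>F\<in>\<F>. \<exists>y. Y - F = {y}" if Y: "Y \<subseteq> X" "Y \<noteq> {}" for Y
    proof -
      have YH: "Y \<in> H" using sc X Y unfolding simplicial_complex_def by blast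
      have finY: "finite Y" using YH mem[of Y] finite_subset[OF _ finV] by simp
      show ?thesis
      proof (cases "card Y \<le> d")
        case True
        obtain y where y: "y \<in> Y" using Y by blast
        have "Y - {y} \<in> \<F>" using y finY True YH mem[of Y] by (auto simp: \<F>_def subsets_le_def)
        moreover have "Y - (Y - {y}) = {y}" using y by blast
        ultimately show ?thesis by blast
      next
        case False
        then show ?thesis using YH mem[of Y] unfolding \<F>_def by auto
      qed
    qed
    then show "X \<in> H'" using X mem[of X] unfolding H'_def separated_def by simp
  qed
  have "simplicial_complex V H'"
    unfolding simplicial_complex_def
  proof (intro conjI ballI allI impI)
    show "{v} \<in> H'" if "v \<in> V" for v using that HH' sc by (auto simp: simplicial_complex_def)
    show "Y \<in> H'" if "X \<in> H'" "Y \<subseteq> X" for X Y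
      using that separated_subset unfolding H'_def by blast
  qed (use finV neV in \<open>auto simp: H'_def\<close>)
  then have "BRSC V H'" unfolding BRSC_iff_separated using fin H'_def by blast
  \<comment> \<open>\<open>H'\<close> may have faces of size above \<open>d + 1\<close>; the
    truncation discards these.\<close>
  moreover have "H = H' \<inter> subsets_le (d + 1) V"
  proof (intro equalityI subsetI)
    fix X assume "X \<in> H"
    then show "X \<in> H' \<inter> subsets_le (d + 1) V" using HH' mem[of X] by (auto simp: subsets_le_def)
  next
    fix X assume X: "X \<in> H' \<inter> subsets_le (d + 1) V"
    then have XV: "X \<subseteq> V" and "separated \<F> X" by (auto simp: H'_def)
    show "X \<in> H"
    proof (cases "card X = d + 1")
      case True
      then have "X \<noteq> {}" by auto
      then obtain F p where F: "F \<in> \<F>" "X - F = {p}"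
        using \<open>separated \<F> X\<close> unfolding separated_def by blast
      have "finite X" using XV finV finite_subset by blast
      then have "card (X \<inter> F) = d" using card_Int_if_Diff_singleton[OF _ F(2)] True by simp
      moreover have "card (X \<inter> F) \<le> card F"
        using F \<open>\<F> \<subseteq> Pow V\<close> finV by (intro card_mono) (auto intro: finite_subset)
      \<comment> \<open>Here \<open>card F\<close> is at least \<open>d\<close>, and
        \<open>d \<ge> 1\<close> guarantees \<open>d - 1 < d\<close> in the natural numbers, so
        \<open>F\<close> is not one of the small sets.\<close>
      ultimately have "F \<in> \<L>" using F \<open>d \<ge> 1\<close> by (auto simp: \<F>_def subsets_le_def)
      then show ?thesis using F XV True mem[of X] by auto
    next
      case False
      then show ?thesis using X XV mem[of X] by (auto simp: subsets_le_def)
    qed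
  qed
  ultimately show ?thesis using sc unfolding TBRSC_def by (metis le_add2)
qed

theorem theorem6p11:
  fixes V :: "'a set" and H :: "'a set set" and d :: nat
  assumes "d \<ge> 2"
    and "simplicial_complex V H"
    and "paving V H"
    and "dimension H = d"
  shows "(V, H) \<in> TBPav d \<longleftrightarrow>
    (\<exists>\<L>. \<L> \<noteq> {} \<and> \<L> \<subseteq> subsets_ge d V - {V} \<and> H = (\<Union>L\<in>\<L>. B_faces d V L))"
proof -
  have d: "d \<ge> 1" using assms(1) by simp
  have "(V, H) \<in> TBPav d \<longleftrightarrow> TBRSC V H" using assms by (simp add: TBPav_def)
  also have "\<dots> \<longleftrightarrow>
      (\<exists>\<L>. \<L> \<noteq> {} \<and> \<L> \<subseteq> subsets_ge d V - {V} \<and> H = (\<Union>L\<in>\<L>. B_faces d V L))"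
    by (rule iffI, erule TBRSC_imp_Union_B_faces[OF d assms(2-4)],
        elim exE conjE, rule Union_B_faces_imp_TBRSC[OF d assms(2)])
  finally show ?thesis .
qed

end
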